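(* Let $s\geq 1$ be an integer and suppose that $\Gamma\in \mathrm{LDT}(s)$ relative to $G$. Let $G^+=\langle G_v \mid v\in V\Gamma\rangle$. Then $\Gamma\in \mathrm{LDT}(s)$ relative to $G^+$. Moreover, if $\Gamma$ is $G^+$-basic, then either $\Gamma\cong K_{m,n}$ for some $m,n$, or $G^+$ is faithful on each of its orbits on $V\Gamma$ and quasiprimitive on at least one of them.
   Context: All graphs are finite, simple and undirected, with vertex set $V\Gamma$ and edge set $E\Gamma$. For a connected graph $\Gamma$, $d_\Gamma$ is the path distance, $\mathrm{diam}(\Gamma)$ its maximum value, and $\Gamma_i(v)=\{w\in V\Gamma : d_\Gamma(v,w)=i\}$. For $G\le \mathrm{Aut}(\Gamma)$, $G_v$ is the stabiliser of the vertex $v$ in $G$. A graph $\Gamma$ is locally $(G,s)$-distance transitive, where $G\le\mathrm{Aut}(\Gamma)$, if $s\le \mathrm{diam}(\Gamma)$ and for each vertex $v$ the group $G_v$ acts transitively on $\Gamma_i(v)$ for all $1\le i\le s$ (vacuous when $s=0$ or $\Gamma_i(v)=\emptyset$). For $s\ge1$, $\mathrm{LDT}(s)$ is the set of connected graphs $\Gamma$ that are locally $(G,s')$-distance transitive for some $G\le\mathrm{Aut}(\Gamma)$, where $s'=\min\{s,\mathrm{diam}(\Gamma)\}$; for such $\Gamma$ and $G$ we say $\Gamma\in\mathrm{LDT}(s)$ relative to $G$. For $N$ normal in $G$, the $G$-normal quotient $\Gamma_N$ is the graph whose vertices are the $N$-orbits on $V\Gamma$, two distinct orbits $B_1,B_2$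 being adjacent iff some $v\in B_1$, $w\in B_2$ are adjacent in $\Gamma$. A graph in $\mathrm{LDT}(s)$ is degenerate if it is isomorphic to $K_1$, $K_2$ or a star $K_{1,r}$ with $r\ge2$, and nondegenerate otherwise. If $\Gamma\in\mathrm{LDT}(s)$ relative to $H$, then $\Gamma$ is $H$-basic if $\Gamma$ is nondegenerate and $\Gamma_N$ is degenerate for every nontrivial normal subgroup $N$ of $H$. An action of a group $H$ on a set is faithful if only the identity fixes every element; a faithful action of $H$ is quasiprimitive if every nontrivial normal subgroup of $H$ is transitive. $K_{m,n}$ is the complete bipartite graph with parts of sizes $m$ and $n$. *)

theory Defs
  imports
    "HOL-Algebra.Group_Action"
    "HOL-Algebra.Generated_Groups"
    "Graph_Theory.Graph_Theory"
begin

text \<open>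
  Finite simple undirected graphs are those satisfying the locale predicate \<open>pair_graph\<close>:
  an edge \<open>{u, v}\<close> is represented by the two arcs \<open>(u, v)\<close> and \<open>(v, u)\<close>.
\<close>

definition Aut :: "'a pair_pre_digraph \<Rightarrow> ('a \<Rightarrow> 'a) monoid" where
  "Aut \<Gamma> = (BijGroup (pverts \<Gamma>))
     \<lparr>carrier := {g \<in> Bij (pverts \<Gamma>).
        \<forall>u \<in> pverts \<Gamma>. \<forall>v \<in> pverts \<Gamma>. (g u, g v) \<in> parcs \<Gamma> \<longleftrightarrow> (u, v) \<in> parcs \<Gamma>}\<rparr>"

abbreviation perm_group :: "'a pair_pre_digraph \<Rightarrow> ('a \<Rightarrow> 'a) set \<Rightarrow> ('a \<Rightarrow> 'a) monoid" where
  "perm_group \<Gamma> G \<equiv> (Aut \<Gamma>)\<lparr>carrier := G\<rparr>"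

text \<open>
  Elements of \<open>perm_group \<Gamma> G\<close> are themselves permutations of the vertex set, so its action on the
  vertices is given by \<open>\<lambda>g. g\<close>, and its action on an invariant set \<open>B\<close> of vertices by \<open>action_on B\<close>.
\<close>

abbreviation vertex_stabilizer :: "'a pair_pre_digraph \<Rightarrow> ('a \<Rightarrow> 'a) set \<Rightarrow> 'a \<Rightarrow> ('a \<Rightarrow> 'a) set" where
  "vertex_stabilizer \<Gamma> G v \<equiv> stabilizer (perm_group \<Gamma> G) (\<lambda>g. g) v"

abbreviation vertex_orbits :: "'a pair_pre_digraph \<Rightarrow> ('a \<Rightarrow> 'a) set \<Rightarrow> 'a set set" where
  "vertex_orbits \<Gamma> G \<equiv> orbits (perm_group \<Gamma> G) (pverts \<Gamma>) (\<lambda>g. g)"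

definition action_on :: "'a set \<Rightarrow> ('a \<Rightarrow> 'a) \<Rightarrow> 'a \<Rightarrow> 'a" where
  "action_on B g = restrict g B"

text \<open>Meaningful only for vertices joined by a path.\<close>

definition graph_dist :: "'a pair_pre_digraph \<Rightarrow> 'a \<Rightarrow> 'a \<Rightarrow> nat" where
  "graph_dist \<Gamma> u v = (LEAST n. \<exists>p. pre_digraph.apath (with_proj \<Gamma>) u p v \<and> length p = n)"

definition graph_diam :: "'a pair_pre_digraph \<Rightarrow> nat" where
  "graph_diam \<Gamma> = Max {graph_dist \<Gamma> u v | u v. u \<in> pverts \<Gamma> \<and> v \<in> pverts \<Gamma>}"

definition graph_sphere :: "'a pair_pre_digraph \<Rightarrow> 'a \<Rightarrow> nat \<Rightarrow> 'a set" where
  "graph_sphere \<Gamma> v i = {w \<in> pverts \<Gamma>. graph_dist \<Gamma> v w = i}"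

definition locally_distance_transitive ::
    "'a pair_pre_digraph \<Rightarrow> ('a \<Rightarrow> 'a) set \<Rightarrow> nat \<Rightarrow> bool" where
  "locally_distance_transitive \<Gamma> G s \<longleftrightarrow>
     subgroup G (Aut \<Gamma>) \<and> s \<le> graph_diam \<Gamma> \<and>
     (\<forall>v \<in> pverts \<Gamma>. \<forall>i \<in> {1..s}.
        transitive_action (perm_group \<Gamma> (vertex_stabilizer \<Gamma> G v))
          (graph_sphere \<Gamma> v i) (action_on (graph_sphere \<Gamma> v i)))"

definition LDT_rel :: "nat \<Rightarrow> 'a pair_pre_digraph \<Rightarrow> ('a \<Rightarrow> 'a) set \<Rightarrow> bool" where
  "LDT_rel s \<Gamma> G \<longleftrightarrow>
     pair_graph \<Gamma> \<and> Digraph_Component.connected (with_proj \<Gamma>) \<and>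
     locally_distance_transitive \<Gamma> G (min s (graph_diam \<Gamma>))"

definition normal_quotient ::
    "'a pair_pre_digraph \<Rightarrow> ('a \<Rightarrow> 'a) set \<Rightarrow> 'a set pair_pre_digraph" where
  "normal_quotient \<Gamma> N =
     \<lparr>pverts = vertex_orbits \<Gamma> N,
      parcs = {(B1, B2). B1 \<in> vertex_orbits \<Gamma> N \<and> B2 \<in> vertex_orbits \<Gamma> N \<and> B1 \<noteq> B2 \<and>
                 (\<exists>v \<in> B1. \<exists>w \<in> B2. (v, w) \<in> parcs \<Gamma>)}\<rparr>"

text \<open>
  The predicates \<open>complete_digraph n\<close> and \<open>complete_bipartite_digraph m n\<close> hold of precisely the
  graphs isomorphic to $K_n$ and $K_{m,n}$.
\<close>

definition degenerate :: "'a pair_pre_digraph \<Rightarrow> bool" where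
  "degenerate \<Gamma> \<longleftrightarrow>
     complete_digraph 1 (with_proj \<Gamma>) \<or> complete_digraph 2 (with_proj \<Gamma>) \<or>
     (\<exists>r\<ge>2. complete_bipartite_digraph 1 r (with_proj \<Gamma>))"

text \<open>Intended for \<open>\<Gamma>\<close> and \<open>H\<close> with \<open>LDT_rel s \<Gamma> H\<close>.\<close>

definition basic :: "'a pair_pre_digraph \<Rightarrow> ('a \<Rightarrow> 'a) set \<Rightarrow> bool" where
  "basic \<Gamma> H \<longleftrightarrow> \<not> degenerate \<Gamma> \<and>
     (\<forall>N. N \<lhd> perm_group \<Gamma> H \<and> N \<noteq> {\<one>\<^bsub>Aut \<Gamma>\<^esub>} \<longrightarrow> degenerate (normal_quotient \<Gamma> N))"

definition quasiprimitive_action ::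
    "('g, 'm) monoid_scheme \<Rightarrow> 'a set \<Rightarrow> ('g \<Rightarrow> 'a \<Rightarrow> 'a) \<Rightarrow> bool" where
  "quasiprimitive_action H B \<phi> \<longleftrightarrow> faithful_action H B \<phi> \<and>
     (\<forall>N. N \<lhd> H \<and> N \<noteq> {\<one>\<^bsub>H\<^esub>} \<longrightarrow> transitive_action (H\<lparr>carrier := N\<rparr>) B \<phi>)"

text \<open>
  The library's \<open>faithful_action\<close> asks for injectivity of \<open>\<phi>\<close>, that is, only the identity fixes
  every point:
\<close>

lemma faithful_action_iff:
  assumes "group_action H B \<phi>"
  shows "faithful_action H B \<phi> \<longleftrightarrow> (\<forall>h \<in> carrier H. (\<forall>x \<in> B. \<phi> h x = x) \<longrightarrow> h = \<one>\<^bsub>H\<^esub>)"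
proof -
  interpret group_action H B \<phi> by fact
  interpret group_hom H "BijGroup B" \<phi> by (rule group_hom)
  have "\<phi> h = \<one>\<^bsub>BijGroup B\<^esub> \<longleftrightarrow> (\<forall>x \<in> B. \<phi> h x = x)" if "h \<in> carrier H" for h
    using bij_prop0[OF that] by (auto simp: BijGroup_def Bij_def intro!: extensionalityI[of _ B])
  then show ?thesis
    using inj_on_one_iff assms by (auto simp: faithful_action_def faithful_action_axioms_def)
qed

definition plus_subgroup :: "'a pair_pre_digraph \<Rightarrow> ('a \<Rightarrow> 'a) set \<Rightarrow> ('a \<Rightarrow> 'a) set" where
  "plus_subgroup \<Gamma> G = generate (Aut \<Gamma>) (\<Union>v \<in> pverts \<Gamma>. vertex_stabilizer \<Gamma> G v)"

end

theory Submission
  imports Defs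
begin

text \<open>
  Let \<open>H = G\<^sup>+\<close>. It contains every \<open>G\<^sub>v\<close> and lies in \<open>G\<close>, so \<open>H\<^sub>v = G\<^sub>v\<close>; local distance
  transitivity refers to vertex stabilisers only and therefore passes from \<open>G\<close> to \<open>H\<close>, and \<open>H\<close>
  is generated by its own vertex stabilisers.

  Since the graph is connected and \<open>H\<^sub>v\<close> is transitive on the neighbours of \<open>v\<close>, every orbit of \<open>H\<close>
  contains an end of every edge (\<open>orbit_vertex_cover\<close>). Hence either \<open>H\<close> is transitive on the vertices or it has exactly two
  orbits, and these form a bipartition (\<open>orbits_bipartition\<close>).

  Suppose that the graph is \<open>H\<close>-basic and that \<open>N\<close> is a nontrivial normal subgroup of \<open>H\<close>. The
  quotient by \<open>N\<close> is a star, if \<open>K\<^sub>1\<close> and \<open>K\<^sub>2\<close> are counted as stars; let the \<open>N\<close>-orbit \<open>C\<close> be its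
  centre. A vertex stabiliser \<open>H\<^sub>v\<close> fixes the \<open>N\<close>-orbit containing \<open>v\<close>, which is \<open>C\<close> or has \<open>C\<close> as
  its only neighbour, so \<open>H\<^sub>v\<close> fixes \<open>C\<close>. As the vertex stabilisers generate \<open>H\<close>, the set \<open>C\<close> is an
  orbit of \<open>H\<close>. Thus every nontrivial normal subgroup of \<open>H\<close> is transitive on some orbit of \<open>H\<close>
  (\<open>basic_normal_transitive_on_some_orbit\<close>).

  Faithfulness follows by applying this to the kernel \<open>K\<close> of \<open>H\<close> on an orbit \<open>B\<close>. A nontrivial \<open>K\<close>
  is transitive on some orbit \<open>D\<close>. If \<open>D = B\<close>, then \<open>B\<close> is a single vertex and the graph is a star;
  otherwise \<open>K\<close> fixes each vertex of \<open>B\<close> and is transitive on \<open>D\<close>, so all edges between \<open>B\<close> and \<open>D\<close>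
  are present. In both cases the graph is complete bipartite.

  If \<open>H\<close> were quasiprimitive on no orbit, there would be two orbits \<open>B\<close> and \<open>D\<close>, a normal subgroup
  \<open>M\<close> transitive on \<open>D\<close> but not on \<open>B\<close>, and a normal subgroup \<open>N\<close> transitive on \<open>B\<close> but not on \<open>D\<close>.
  Their intersection is transitive on neither orbit, hence trivial, so \<open>M\<close> and \<open>N\<close> commute. On \<open>B\<close> the
  group \<open>M\<close> acts faithfully and is centralised by a transitive group, so it is semiregular there;
  it is intransitive on \<open>B\<close> and transitive on \<open>D\<close>, whence \<open>|D| \<le> |M| < |B|\<close>; by symmetry \<open>|B| \<le> |N| < |D|\<close>, a contradiction.
\<close>

section \<open>Group actions and normal subgroups\<close>

text \<open>The commutator of \<open>m\<close> and \<open>n\<close> lies in both subgroups.\<close>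

lemma (in group) disjoint_normal_commute:
  assumes "M \<lhd> G" "N \<lhd> G" "M \<inter> N = {\<one>}" "m \<in> M" "n \<in> N"
  shows "m \<otimes> n = n \<otimes> m"
proof -
  interpret M: normal M G by fact
  interpret N: normal N G by fact
  have m: "m \<in> carrier G" and n: "n \<in> carrier G" using assms M.subset N.subset by auto
  have "m \<otimes> n \<otimes> inv m \<otimes> inv n \<in> N"
    using N.inv_op_closed2[OF m assms(5)] assms(5) N.m_closed N.m_inv_closed by auto
  moreover have "m \<otimes> (n \<otimes> inv m \<otimes> inv n) \<in> M"
    using M.inv_op_closed2[OF n, of "inv m"] assms(4) M.m_closed M.m_inv_closed by auto
  moreover have "m \<otimes> (n \<otimes> inv m \<otimes> inv n) = m \<otimes> n \<otimes> inv m \<otimes> inv n"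
    using m n by (simp add: m_assoc)
  ultimately have "m \<otimes> n \<otimes> inv m \<otimes> inv n = \<one>" using assms(3) by auto
  then have "m \<otimes> n \<otimes> inv (n \<otimes> m) = \<one>" using m n by (simp add: inv_mult_group m_assoc)
  then show ?thesis using m n by (metis inv_closed inv_inv inv_equality m_closed)
qed

context group_action
begin

lemma orbit_eq:
  assumes "x \<in> E" "y \<in> Group_Action.orbit G \<phi> x"
  shows "Group_Action.orbit G \<phi> y = Group_Action.orbit G \<phi> x"
proof -
  have "y \<in> E" using assms element_image by (auto simp: Group_Action.orbit_def)
  then show ?thesis
    using disjoint_union[of "Group_Action.orbit G \<phi> y" "Group_Action.orbit G \<phi> x"] orbit_refl[of y] assms
    by (auto simp: orbits_def)
qed

lemma orbits_eq_orbit: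
  assumes "B \<in> orbits G E \<phi>" "x \<in> B"
  shows "B = Group_Action.orbit G \<phi> x" "x \<in> E"
proof -
  obtain y where "y \<in> E" "B = Group_Action.orbit G \<phi> y"
    using assms(1) unfolding orbits_def by blast
  then show "B = Group_Action.orbit G \<phi> x" using orbit_eq assms(2) by metis
  show "x \<in> E" using orbits_coverture assms by blast
qed

text \<open>
  Applied to the inverses, invariance turns the inclusion \<open>\<phi> g ` B \<subseteq> B\<close> into an equality.
\<close>

lemma restricted_action:
  assumes "B \<subseteq> E" and invariant: "\<And>g. g \<in> carrier G \<Longrightarrow> \<phi> g ` B \<subseteq> B"
  shows "group_action G B (\<lambda>g. restrict (\<phi> g) B)"
proof -
  interpret hom: group_hom G "BijGroup E" \<phi> by (rule group_hom)
  have Bij: "restrict (\<phi> g) B \<in> Bij B" if g: "g \<in> carrier G" for g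
  proof -
    have "y \<in> \<phi> g ` B" if "y \<in> B" for y
    proof (rule image_eqI)
      show "\<phi> (inv g) y \<in> B" using invariant[of "inv g"] g that by auto
      show "y = \<phi> g (\<phi> (inv g) y)"
        using orbit_sym_aux[of "inv g" y] g that assms(1) by auto
    qed
    then have "\<phi> g ` B = B" using invariant[OF g] by auto
    then show ?thesis
      using inj_on_subset[OF inj_prop[OF g] assms(1)] by (auto simp: Bij_def bij_betw_def)
  qed
  have "restrict (\<phi> (g \<otimes> h)) B = compose B (restrict (\<phi> g) B) (restrict (\<phi> h) B)"
    if "g \<in> carrier G" "h \<in> carrier G" for g h
  proof
    fix x
    have "\<phi> h x \<in> B" if "x \<in> B" using invariant[OF \<open>h \<in> carrier G\<close>] that by blast
    moreover have "\<phi> (g \<otimes> h) x = \<phi> g (\<phi> h x)" if "x \<in> B"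
      using composition_rule[of x g h] that \<open>g \<in> carrier G\<close> \<open>h \<in> carrier G\<close> assms(1) by blast
    ultimately show "restrict (\<phi> (g \<otimes> h)) B x = compose B (restrict (\<phi> g) B) (restrict (\<phi> h) B) x"
      by (simp add: compose_def)
  qed
  then show ?thesis
    using Bij hom.G.group_axioms group_BijGroup[of B]
    by (simp add: group_action_def group_hom_def group_hom_axioms_def hom_def BijGroup_def)
qed

lemma transitive_on_orbit:
  assumes "B \<in> orbits G E \<phi>"
  shows "transitive_action G B (\<lambda>g. restrict (\<phi> g) B)"
proof -
  have B: "B = Group_Action.orbit G \<phi> x" "x \<in> E" if "x \<in> B" for x using orbits_eq_orbit[OF assms that] .
  have "group_action G B (\<lambda>g. restrict (\<phi> g) B)"
    using B by (intro restricted_action) (auto simp: Group_Action.orbit_def)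
  then show ?thesis
    using B by (fastforce simp: transitive_action_def transitive_action_axioms_def Group_Action.orbit_def)
qed

text \<open>The orbits of a normal subgroup are blocks, because \<open>g n x = (g n inv g) (g x)\<close>.\<close>

lemma normal_orbit_image:
  assumes "N \<lhd> G" "g \<in> carrier G" "x \<in> E"
  shows "\<phi> g ` Group_Action.orbit (G\<lparr>carrier := N\<rparr>) \<phi> x = Group_Action.orbit (G\<lparr>carrier := N\<rparr>) \<phi> (\<phi> g x)"
proof -
  interpret N: normal N G by fact
  have 1: "\<phi> g (\<phi> n x) = \<phi> (g \<otimes> n \<otimes> inv g) (\<phi> g x)" if "n \<in> N" for n
  proof -
    have n: "n \<in> carrier G" using that N.subset by auto
    have "\<phi> (g \<otimes> n \<otimes> inv g) (\<phi> g x) = \<phi> (g \<otimes> n \<otimes> inv g \<otimes> g) x"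
      using composition_rule[of x "g \<otimes> n \<otimes> inv g" g] n assms by simp
    also have "\<dots> = \<phi> (g \<otimes> n) x" using n assms by (simp add: N.m_assoc)
    finally show ?thesis using composition_rule n assms by simp
  qed
  have "\<exists>n'\<in>N. n = g \<otimes> n' \<otimes> inv g" if "n \<in> N" for n
  proof (rule bexI)
    show "inv g \<otimes> n \<otimes> g \<in> N" using N.inv_op_closed1[OF assms(2) that] .
    have "n \<in> carrier G" using that N.subset by auto
    then show "n = g \<otimes> (inv g \<otimes> n \<otimes> g) \<otimes> inv g"
      using assms(2) by (simp add: N.m_assoc flip: N.m_assoc[of g "inv g"])
  qed
  then have conj: "(\<lambda>n. g \<otimes> n \<otimes> inv g) ` N = N"
    using N.inv_op_closed2[OF assms(2)] by blast
  have "(\<lambda>n. \<phi> g (\<phi> n x)) ` N = (\<lambda>n. \<phi> n (\<phi> g x)) ` (\<lambda>n. g \<otimes> n \<otimes> inv g) ` N"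
    unfolding image_image by (rule image_cong[OF refl 1])
  also have "\<dots> = (\<lambda>n. \<phi> n (\<phi> g x)) ` N" unfolding conj ..
  finally show ?thesis by (simp add: Group_Action.orbit_def Setcompr_eq_image image_image)
qed

lemma transitive_action_mono:
  assumes "transitive_action (G\<lparr>carrier := M\<rparr>) E \<phi>" "M \<subseteq> N" "subgroup N G"
  shows "transitive_action (G\<lparr>carrier := N\<rparr>) E \<phi>"
  using assms induced_action[OF assms(3)]
  by (fastforce simp: transitive_action_def transitive_action_axioms_def)

end

lemma (in transitive_action) card_le_carrier:
  assumes "finite (carrier G)"
  shows "card E \<le> card (carrier G)"
proof (cases "E = {}")
  case False
  then obtain x where "x \<in> E" by auto
  then have "E \<subseteq> (\<lambda>g. \<phi> g x) ` carrier G" using unique_orbit by blast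
  then show ?thesis using assms by (meson surj_card_le)
qed simp

text \<open>
  The fixed points of \<open>m\<close> form a set invariant under the centraliser of \<open>m\<close>; if that contains a
  transitive group, a single fixed point forces \<open>m\<close> to fix everything.
\<close>

lemma (in faithful_action) semiregular_if_centralizes_transitive:
  assumes "N \<subseteq> carrier G" and tr: "transitive_action (G\<lparr>carrier := N\<rparr>) E \<phi>"
    and m: "m \<in> carrier G" and comm: "\<And>n. n \<in> N \<Longrightarrow> m \<otimes> n = n \<otimes> m"
    and x: "x \<in> E" "\<phi> m x = x"
  shows "m = \<one>"
proof -
  have "\<phi> m y = y" if y: "y \<in> E" for y
  proof -
    obtain n where n: "n \<in> N" "\<phi> n x = y" using transitive_action.unique_orbit[OF tr x(1) y] by auto
    then have "n \<in> carrier G" using assms(1) by auto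
    then have "\<phi> m (\<phi> n x) = \<phi> n (\<phi> m x)"
      using composition_rule[of x m n] composition_rule[of x n m] comm[OF n(1)] m x by simp
    then show ?thesis using n x by simp
  qed
  then show ?thesis
    using faithful_action_iff[OF group_action_axioms] faithful_action_axioms m by blast
qed

text \<open>
  By semiregularity \<open>M\<close> is in bijection with each of its orbits, and these are proper subsets of \<open>E\<close>.
\<close>

lemma (in faithful_action) card_intransitive_normal_less:
  assumes "finite E" and N: "N \<lhd> G" and M: "M \<lhd> G" and disj: "M \<inter> N = {\<one>}"
    and tr: "transitive_action (G\<lparr>carrier := N\<rparr>) E \<phi>"
    and intr: "\<not> transitive_action (G\<lparr>carrier := M\<rparr>) E \<phi>"
  shows "finite M" "card M < card E"
proof -
  interpret M: normal M G by fact
  interpret N: normal N G by fact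
  have semi: "m = m'" if "x \<in> E" "m \<in> M" "m' \<in> M" "\<phi> m x = \<phi> m' x" for x m m'
  proof -
    have c: "m \<in> carrier G" "m' \<in> carrier G" using that M.subset by auto
    have "\<phi> (inv m' \<otimes> m) x = x"
      using composition_rule[of x "inv m'" m] orbit_sym_aux[of m' x] c that by simp
    moreover have "inv m' \<otimes> m \<in> M" using that by simp
    ultimately have "inv m' \<otimes> m = \<one>"
      using semiregular_if_centralizes_transitive[OF N.subset tr, of "inv m' \<otimes> m" x]
        M.disjoint_normal_commute[OF M N disj] c that(1) by auto
    then show ?thesis using c by (metis M.inv_closed M.inv_equality M.inv_inv)
  qed
  have "group_action (G\<lparr>carrier := M\<rparr>) E \<phi>" by (rule induced_action[OF M.subgroup_axioms])
  then obtain x y where xy: "x \<in> E" "y \<in> E" "\<forall>m\<in>M. \<phi> m x \<noteq> y"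
    using intr by (auto simp: transitive_action_def transitive_action_axioms_def)
  have inj: "inj_on (\<lambda>m. \<phi> m x) M" using semi xy by (auto intro: inj_onI)
  have sub: "(\<lambda>m. \<phi> m x) ` M \<subset> E"
    using xy element_image[of _ x] M.subset by blast
  show "finite M" using inj sub assms(1) by (meson finite_imageD finite_subset psubset_imp_subset)
  show "card M < card E"
    using psubset_card_mono[OF assms(1) sub] card_image[OF inj] by simp
qed

section \<open>Automorphism groups acting on vertices\<close>

lemma subgroup_Aut: "subgroup (carrier (Aut \<Gamma>)) (BijGroup (pverts \<Gamma>))"
proof -
  interpret group "BijGroup (pverts \<Gamma>)" by (rule group_BijGroup)
  let ?V = "pverts \<Gamma>"
  show ?thesis
  proof (rule subgroupI)
    show "carrier (Aut \<Gamma>) \<subseteq> carrier (BijGroup ?V)" by (auto simp: Aut_def BijGroup_def)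
    show "carrier (Aut \<Gamma>) \<noteq> {}" using id_Bij[of ?V] by (auto simp: Aut_def)
  next
    fix g assume g: "g \<in> carrier (Aut \<Gamma>)"
    then have B: "g \<in> Bij ?V" by (simp add: Aut_def)
    have "(inv_into ?V g u, inv_into ?V g v) \<in> parcs \<Gamma> \<longleftrightarrow> (u, v) \<in> parcs \<Gamma>"
      if "u \<in> ?V" "v \<in> ?V" for u v
    proof -
      have eq: "g (inv_into ?V g u) = u" "g (inv_into ?V g v) = v"
        using that B bij_betw_inv_into_right[of g ?V ?V] by (simp_all add: Bij_def)
      have "(g (inv_into ?V g u), g (inv_into ?V g v)) \<in> parcs \<Gamma>
          \<longleftrightarrow> (inv_into ?V g u, inv_into ?V g v) \<in> parcs \<Gamma>"
        using g Bij_inv_into_mem[OF B] that by (simp add: Aut_def)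
      then show ?thesis unfolding eq by simp
    qed
    then show "inv\<^bsub>BijGroup ?V\<^esub> g \<in> carrier (Aut \<Gamma>)"
      using restrict_inv_into_Bij[OF B] by (auto simp: inv_BijGroup[OF B] Aut_def)
  next
    fix g h assume "g \<in> carrier (Aut \<Gamma>)" "h \<in> carrier (Aut \<Gamma>)"
    then show "g \<otimes>\<^bsub>BijGroup ?V\<^esub> h \<in> carrier (Aut \<Gamma>)"
      using Bij_imp_funcset[of h ?V]
      by (auto simp: Aut_def BijGroup_def compose_Bij compose_eq Pi_iff)
  qed
qed

lemma group_Aut: "group (Aut \<Gamma>)"
proof -
  have "(BijGroup (pverts \<Gamma>))\<lparr>carrier := carrier (Aut \<Gamma>)\<rparr> = Aut \<Gamma>" by (simp add: Aut_def)
  then show ?thesis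
    using group.subgroup_imp_group[OF group_BijGroup subgroup_Aut, of \<Gamma>] by (simp only:)
qed

lemma group_action_Aut: "group_action (Aut \<Gamma>) (pverts \<Gamma>) (\<lambda>g. g)"
proof -
  have "(\<lambda>g. g) \<in> hom (Aut \<Gamma>) (BijGroup (pverts \<Gamma>))"
    by (auto simp: hom_def Aut_def BijGroup_def)
  then show ?thesis
    by (simp add: group_action_def group_hom_def group_hom_axioms_def group_Aut group_BijGroup)
qed

lemma group_action_perm_group:
  "subgroup H (Aut \<Gamma>) \<Longrightarrow> group_action (perm_group \<Gamma> H) (pverts \<Gamma>) (\<lambda>g. g)"
  using group_action.induced_action[OF group_action_Aut] by blast

abbreviation vertex_orbit :: "'a pair_pre_digraph \<Rightarrow> ('a \<Rightarrow> 'a) set \<Rightarrow> 'a \<Rightarrow> 'a set" where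
  "vertex_orbit \<Gamma> H v \<equiv> Group_Action.orbit (perm_group \<Gamma> H) (\<lambda>g. g) v"

lemma vertex_stabilizer_eq: "vertex_stabilizer \<Gamma> H v = {g \<in> H. g v = v}"
  by (simp add: stabilizer_def)

lemma
  assumes G: "subgroup G (Aut \<Gamma>)"
  shows subgroup_plus: "subgroup (plus_subgroup \<Gamma> G) (Aut \<Gamma>)"
    and vertex_stabilizer_plus:
      "v \<in> pverts \<Gamma> \<Longrightarrow> vertex_stabilizer \<Gamma> (plus_subgroup \<Gamma> G) v = vertex_stabilizer \<Gamma> G v"
    and plus_subgroup_idem: "plus_subgroup \<Gamma> (plus_subgroup \<Gamma> G) = plus_subgroup \<Gamma> G"
proof -
  interpret group "Aut \<Gamma>" by (rule group_Aut)
  let ?S = "\<Union>v \<in> pverts \<Gamma>. vertex_stabilizer \<Gamma> G v"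
  have S: "?S \<subseteq> G" by (auto simp: vertex_stabilizer_eq)
  show "subgroup (plus_subgroup \<Gamma> G) (Aut \<Gamma>)"
    using S subgroup.subset[OF G] generate_is_subgroup unfolding plus_subgroup_def by blast
  have "plus_subgroup \<Gamma> G \<subseteq> G"
    using generate_subgroup_incl[OF S G] by (simp add: plus_subgroup_def)
  moreover have "vertex_stabilizer \<Gamma> G v \<subseteq> plus_subgroup \<Gamma> G" if "v \<in> pverts \<Gamma>" for v
    using that by (auto simp: plus_subgroup_def intro: generate.incl)
  ultimately show *: "vertex_stabilizer \<Gamma> (plus_subgroup \<Gamma> G) v = vertex_stabilizer \<Gamma> G v"
    if "v \<in> pverts \<Gamma>" for v
    using that by (fastforce simp: vertex_stabilizer_eq)
  show "plus_subgroup \<Gamma> (plus_subgroup \<Gamma> G) = plus_subgroup \<Gamma> G"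
    unfolding plus_subgroup_def[of \<Gamma> "plus_subgroup \<Gamma> G"] using *
    by (simp add: plus_subgroup_def)
qed

lemma LDT_rel_plus:
  assumes "LDT_rel s \<Gamma> G"
  shows "LDT_rel s \<Gamma> (plus_subgroup \<Gamma> G)"
  using assms vertex_stabilizer_plus[of G \<Gamma>] subgroup_plus[of G \<Gamma>]
  by (simp add: LDT_rel_def locally_distance_transitive_def)

section \<open>Degenerate graphs and normal quotients\<close>

text \<open>
  \<open>K\<^sub>1\<close> and \<open>K\<^sub>2\<close> are treated as stars with no leaf and with one leaf, so that later arguments
  need not distinguish the three kinds of degenerate graphs.
\<close>

lemma degenerate_imp_star:
  assumes "degenerate \<Delta>"
  shows "\<exists>c \<in> pverts \<Delta>. parcs \<Delta> = {c} \<times> (pverts \<Delta> - {c}) \<union> (pverts \<Delta> - {c}) \<times> {c}"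
  using assms unfolding degenerate_def
proof (elim disjE exE conjE)
  assume "complete_digraph 1 (with_proj \<Delta>)"
  then show ?thesis by (auto simp: complete_digraph_pair_def card_1_singleton_iff)
next
  assume "complete_digraph 2 (with_proj \<Delta>)"
  then show ?thesis by (auto simp: complete_digraph_pair_def card_2_iff)
next
  fix r assume "complete_bipartite_digraph 1 r (with_proj \<Delta>)"
  then obtain U V where "pverts \<Delta> = U \<union> V" "U \<inter> V = {}" "card U = 1"
    "parcs \<Delta> = U \<times> V \<union> V \<times> U"
    by (auto simp: complete_bipartite_digraph_pair_def)
  then show ?thesis by (auto simp: card_1_singleton_iff)
qed

text \<open>
  The common orbit is the centre \<open>C\<close> of the star \<open>\<Gamma>\<^sub>N\<close>. An element fixing \<open>v\<close> fixes the \<open>N\<close>-orbit of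
  \<open>v\<close>, and this orbit either is \<open>C\<close> or determines \<open>C\<close> as its unique neighbour; so \<open>C\<close> is invariant
  under the group generated by the vertex stabilisers, which is \<open>H\<close>.
\<close>

lemma degenerate_quotient_common_orbit:
  assumes H: "subgroup H (Aut \<Gamma>)" and plus: "plus_subgroup \<Gamma> H = H"
    and N: "N \<lhd> perm_group \<Gamma> H" and deg: "degenerate (normal_quotient \<Gamma> N)"
  shows "\<exists>B \<in> vertex_orbits \<Gamma> H. B \<in> vertex_orbits \<Gamma> N"
proof -
  interpret A: group "Aut \<Gamma>" by (rule group_Aut)
  interpret H: group_action "perm_group \<Gamma> H" "pverts \<Gamma>" "\<lambda>g. g"
    by (rule group_action_perm_group[OF H])
  interpret N: normal N "perm_group \<Gamma> H" by fact
  have NH: "N \<subseteq> H" using N.subset by simp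
  have NA: "subgroup N (Aut \<Gamma>)" using A.incl_subgroup[OF H N.subgroup_axioms] .
  interpret Nact: group_action "perm_group \<Gamma> N" "pverts \<Gamma>" "\<lambda>g. g"
    by (rule group_action_perm_group[OF NA])
  let ?Q = "normal_quotient \<Gamma> N" and ?orb = "vertex_orbit \<Gamma> N"
  have img: "g ` ?orb x = ?orb (g x)" if "g \<in> H" "x \<in> pverts \<Gamma>" for g x
    using H.normal_orbit_image[OF N, of g x] that by simp
  have HV: "g x \<in> pverts \<Gamma>" if "g \<in> H" "x \<in> pverts \<Gamma>" for g x
    using H.element_image[of g x] that by simp
  obtain C where C: "C \<in> vertex_orbits \<Gamma> N"
    and star: "parcs ?Q = {C} \<times> (pverts ?Q - {C}) \<union> (pverts ?Q - {C}) \<times> {C}"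
    using degenerate_imp_star[OF deg] by (auto simp: normal_quotient_def)
  obtain c where c: "c \<in> pverts \<Gamma>" "C = ?orb c" using C by (auto simp: orbits_def)
  have img_C: "g ` C \<in> vertex_orbits \<Gamma> N" if "g \<in> H" for g
    using img[OF that c(1)] HV[OF that c(1)] c by (auto simp: orbits_def)
  have stab: "g ` C = C" if v: "v \<in> pverts \<Gamma>" and g: "g \<in> H" "g v = v" for g v
  proof -
    let ?L = "?orb v"
    have L: "?L \<in> vertex_orbits \<Gamma> N" using v by (auto simp: orbits_def)
    have gL: "g ` ?L = ?L" using img[OF g(1) v] g(2) by simp
    show ?thesis
    proof (cases "?L = C")
      case False
      then have "(C, ?L) \<in> parcs ?Q" using star L by (auto simp: normal_quotient_def)
      then obtain a b where ab: "a \<in> C" "b \<in> ?L" "(a, b) \<in> parcs \<Gamma>"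
        by (auto simp: normal_quotient_def)
      then have V: "a \<in> pverts \<Gamma>" "b \<in> pverts \<Gamma>"
        using Nact.orbits_coverture C L by auto
      have inj: "inj_on g (pverts \<Gamma>)" using H.inj_prop[of g] g by simp
      have "(g a, g b) \<in> parcs \<Gamma>" using ab V g subgroup.subset[OF H] by (auto simp: Aut_def)
      moreover have "g ` C \<noteq> ?L"
      proof
        assume "g ` C = ?L"
        then have "g ` C = g ` ?L" using gL by simp
        moreover have "C \<subseteq> pverts \<Gamma>" "?L \<subseteq> pverts \<Gamma>"
          using Nact.orbits_coverture C L by auto
        ultimately show False using False inj_on_image_eq_iff[OF inj] by blast
      qed
      ultimately have "(g ` C, ?L) \<in> parcs ?Q"
        using ab gL L img_C[OF g(1)] by (auto simp: normal_quotient_def)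
      then show ?thesis using star False by auto
    qed (use gL in simp)
  qed
  have fixes_C: "g ` C = C" if "g \<in> plus_subgroup \<Gamma> H" for g
    using that unfolding plus_subgroup_def
  proof induction
    case one
    have "\<one>\<^bsub>Aut \<Gamma>\<^esub> \<in> H" "\<one>\<^bsub>Aut \<Gamma>\<^esub> c = c"
      using subgroup.one_closed[OF H] c by (auto simp: Aut_def BijGroup_def)
    then show ?case using stab c by blast
  next
    case (incl h)
    then show ?case using stab by (auto simp: vertex_stabilizer_eq)
  next
    case (inv h)
    then obtain v where v: "v \<in> pverts \<Gamma>" "h \<in> vertex_stabilizer \<Gamma> H v" by auto
    then have "inv\<^bsub>perm_group \<Gamma> H\<^esub> h \<in> vertex_stabilizer \<Gamma> H v"
      using H.stabilizer_m_inv_closed by blast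
    then have "inv\<^bsub>Aut \<Gamma>\<^esub> h \<in> vertex_stabilizer \<Gamma> H v"
      using v A.m_inv_consistent[OF H, of h] by (simp add: vertex_stabilizer_eq)
    then show ?case using stab v by (auto simp: vertex_stabilizer_eq)
  next
    case (eng g h)
    then have "g \<in> H" "h \<in> H" using plus unfolding plus_subgroup_def by auto
    then have "(g \<otimes>\<^bsub>Aut \<Gamma>\<^esub> h) x = g (h x)" if "x \<in> pverts \<Gamma>" for x
      using H.composition_rule[OF that, of g h] by simp
    moreover have "C \<subseteq> pverts \<Gamma>" using Nact.orbits_coverture C by auto
    ultimately have "(g \<otimes>\<^bsub>Aut \<Gamma>\<^esub> h) ` C = g ` h ` C" by (force simp: image_iff)
    then show ?case using eng by simp
  qed
  have "c \<in> C" using c Nact.orbit_refl by simp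
  then have "vertex_orbit \<Gamma> H c \<subseteq> C"
    using fixes_C plus by (auto simp: Group_Action.orbit_def)
  moreover have "C \<subseteq> vertex_orbit \<Gamma> H c"
    using c NH by (auto simp: Group_Action.orbit_def)
  ultimately have "C = vertex_orbit \<Gamma> H c" by simp
  then show ?thesis using C c by (auto simp: orbits_def)
qed

section \<open>Orbits in locally transitive graphs\<close>

text \<open>
  Of local distance transitivity only the case of distance 1 is kept, stated without reference to
  distances.
\<close>

locale locally_transitive_graph = pair_graph \<Gamma>
  for \<Gamma> :: "'a pair_pre_digraph" +
  fixes H :: "('a \<Rightarrow> 'a) set"
  assumes H_subgroup: "subgroup H (Aut \<Gamma>)"
    and connected: "Digraph_Component.connected (with_proj \<Gamma>)"
    and locally_transitive:
      "\<lbrakk>(v, u) \<in> parcs \<Gamma>; (v, w) \<in> parcs \<Gamma>\<rbrakk> \<Longrightarrow> \<exists>g \<in> H. g v = v \<and> g u = w"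

sublocale locally_transitive_graph \<subseteq> H: group_action "perm_group \<Gamma> H" "pverts \<Gamma>" "\<lambda>g. g"
  by (rule group_action_perm_group[OF H_subgroup])

context locally_transitive_graph
begin

lemma arc_image: "\<lbrakk>g \<in> H; (u, v) \<in> parcs \<Gamma>\<rbrakk> \<Longrightarrow> (g u, g v) \<in> parcs \<Gamma>"
  using subgroup.subset[OF H_subgroup] by (fastforce simp: Aut_def dest: in_arcsD1 in_arcsD2)

lemma connected_closed_set:
  assumes "x \<in> S" "x \<in> pverts \<Gamma>" and "\<And>a b. \<lbrakk>a \<in> S; (a, b) \<in> parcs \<Gamma>\<rbrakk> \<Longrightarrow> b \<in> S"
  shows "pverts \<Gamma> \<subseteq> S"
proof
  fix y assume y: "y \<in> pverts \<Gamma>"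
  have "x \<rightarrow>\<^sup>*\<^bsub>with_proj \<Gamma>\<^esub> y"
    using symmetric_connected_imp_strongly_connected[OF _ connected] pair_sym_arcs assms(2) y
    by (auto simp: strongly_connected_def)
  then show "y \<in> S"
    by (induction rule: reachable_induct) (use assms in \<open>auto simp: arcs_ends_conv\<close>)
qed

lemma has_neighbour:
  assumes "x \<in> pverts \<Gamma>" "y \<in> pverts \<Gamma>" "x \<noteq> y"
  obtains z where "(x, z) \<in> parcs \<Gamma>"
  using connected_closed_set[of x "{x}"] assms by auto

text \<open>
  If \<open>a\<close> is in the orbit of \<open>u\<close>, then every neighbour \<open>b\<close> of \<open>a\<close> is in the orbit of \<open>v\<close>: move \<open>a\<close> to
  \<open>u\<close>, so that \<open>b\<close> becomes a neighbour of \<open>u\<close>, and then use that the stabiliser of \<open>u\<close> is transitive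
  on the neighbours of \<open>u\<close>. The same holds with \<open>u\<close> and \<open>v\<close> exchanged, so the union of the two
  orbits is closed under adjacency, and connectedness gives the claim.
\<close>

lemma two_orbits:
  assumes uv: "(u, v) \<in> parcs \<Gamma>"
  shows "pverts \<Gamma> \<subseteq> vertex_orbit \<Gamma> H u \<union> vertex_orbit \<Gamma> H v"
    (is "_ \<subseteq> ?orb u \<union> ?orb v")
proof -
  have step: "b \<in> ?orb v" if uv: "(u, v) \<in> parcs \<Gamma>" and a: "a \<in> ?orb u" and ab: "(a, b) \<in> parcs \<Gamma>"
    for u v a b
  proof -
    have V: "u \<in> pverts \<Gamma>" "v \<in> pverts \<Gamma>" "a \<in> pverts \<Gamma>" "b \<in> pverts \<Gamma>"
      using uv ab in_arcsD1 in_arcsD2 by auto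
    have "u \<in> ?orb a" using H.orbit_sym V a by blast
    then obtain g where g: "g \<in> H" "g a = u" by (auto simp: Group_Action.orbit_def)
    then have "(u, g b) \<in> parcs \<Gamma>" using arc_image[OF _ ab] by blast
    then obtain h where h: "h \<in> H" "h v = g b" using locally_transitive uv by blast
    have gb: "g b \<in> pverts \<Gamma>" using H.element_image[of g b] g V by simp
    have "g b \<in> ?orb b" using g by (auto simp: Group_Action.orbit_def)
    moreover have "g b \<in> ?orb v"
      using h(1) unfolding h(2)[symmetric] by (auto simp: Group_Action.orbit_def)
    ultimately show ?thesis using H.orbit_sym H.orbit_trans V gb by blast
  qed
  have "(v, u) \<in> parcs \<Gamma>" using uv by (rule arcs_symmetric)
  then show ?thesis
    using connected_closed_set[of u "?orb u \<union> ?orb v"] step uv H.orbit_refl in_arcsD1[OF uv]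
    by blast
qed

lemma orbit_vertex_cover:
  assumes "B \<in> vertex_orbits \<Gamma> H" "(u, v) \<in> parcs \<Gamma>"
  shows "u \<in> B \<or> v \<in> B"
proof -
  obtain x where x: "x \<in> pverts \<Gamma>" "B = vertex_orbit \<Gamma> H x"
    using assms(1) by (auto simp: orbits_def)
  have "u \<in> pverts \<Gamma>" "v \<in> pverts \<Gamma>" using assms(2) in_arcsD1 in_arcsD2 by auto
  then show ?thesis using two_orbits[OF assms(2)] x H.orbit_sym by blast
qed

lemma orbit_nonempty: "B \<in> vertex_orbits \<Gamma> H \<Longrightarrow> B \<noteq> {} \<and> B \<subseteq> pverts \<Gamma>"
  using H.orbits_coverture H.orbit_refl by (fastforce simp: orbits_def)

text \<open>
  Two disjoint vertex covers split every edge between them, and in a connected graph with at least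
  two vertices every vertex lies on an edge.
\<close>

lemma orbits_bipartition:
  assumes B: "B \<in> vertex_orbits \<Gamma> H" and D: "D \<in> vertex_orbits \<Gamma> H" and "B \<noteq> D"
  shows "B \<inter> D = {}" "pverts \<Gamma> = B \<union> D" "parcs \<Gamma> \<subseteq> B \<times> D \<union> D \<times> B"
    "vertex_orbits \<Gamma> H = {B, D}"
proof -
  show disj: "B \<inter> D = {}" using H.disjoint_union[OF B D] assms(3) by auto
  note cover = orbit_vertex_cover[OF B] orbit_vertex_cover[OF D]
  show arcs: "parcs \<Gamma> \<subseteq> B \<times> D \<union> D \<times> B" using cover disj by fastforce
  obtain x y where xy: "x \<in> B" "y \<in> D" "x \<in> pverts \<Gamma>" "y \<in> pverts \<Gamma>" "x \<noteq> y"
    using orbit_nonempty[OF B] orbit_nonempty[OF D] disj by blast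
  have "v \<in> B \<union> D" if v: "v \<in> pverts \<Gamma>" for v
  proof -
    obtain z where "(v, z) \<in> parcs \<Gamma>" using has_neighbour[of v] v xy by metis
    then show ?thesis using arcs by auto
  qed
  then show V: "pverts \<Gamma> = B \<union> D" using orbit_nonempty[OF B] orbit_nonempty[OF D] by auto
  have "C = B \<or> C = D" if C: "C \<in> vertex_orbits \<Gamma> H" for C
    using orbit_nonempty[OF C] V H.disjoint_union[OF C B] H.disjoint_union[OF C D] by blast
  then show "vertex_orbits \<Gamma> H = {B, D}" using B D by auto
qed

lemma orbit_transitive_action:
  assumes "B \<in> vertex_orbits \<Gamma> H"
  shows "transitive_action (perm_group \<Gamma> H) B (action_on B)"
  using H.transitive_on_orbit[OF assms] by (simp add: action_on_def[abs_def])

lemma orbit_group_action: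
  assumes "B \<in> vertex_orbits \<Gamma> H"
  shows "group_action (perm_group \<Gamma> H) B (action_on B)"
  using orbit_transitive_action[OF assms] by (simp add: transitive_action_def)

section \<open>Basic graphs\<close>

lemma basic_normal_transitive_on_some_orbit:
  assumes "basic \<Gamma> H" "plus_subgroup \<Gamma> H = H" and N: "N \<lhd> perm_group \<Gamma> H"
    and "N \<noteq> {\<one>\<^bsub>Aut \<Gamma>\<^esub>}"
  shows "\<exists>B \<in> vertex_orbits \<Gamma> H. transitive_action (perm_group \<Gamma> N) B (action_on B)"
proof -
  have "degenerate (normal_quotient \<Gamma> N)" using assms by (simp add: basic_def)
  then obtain B where B: "B \<in> vertex_orbits \<Gamma> H" "B \<in> vertex_orbits \<Gamma> N"
    using degenerate_quotient_common_orbit[OF H_subgroup assms(2) N] by blast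
  have "subgroup N (Aut \<Gamma>)"
    using group.incl_subgroup[OF group_Aut H_subgroup normal_imp_subgroup[OF N]] .
  then show ?thesis
    using B group_action.transitive_on_orbit[OF group_action_perm_group]
    by (auto simp: action_on_def[abs_def])
qed

lemma complete_bipartiteI:
  assumes "pverts \<Gamma> = B \<union> D" "B \<inter> D = {}" "parcs \<Gamma> \<subseteq> B \<times> D \<union> D \<times> B" "B \<times> D \<subseteq> parcs \<Gamma>"
  shows "complete_bipartite_digraph (card B) (card D) (with_proj \<Gamma>)"
proof -
  have "parcs \<Gamma> = B \<times> D \<union> D \<times> B" using assms arcs_symmetric by blast
  then show ?thesis
    unfolding complete_bipartite_digraph_pair_def using assms pair_finite_verts by blast
qed

text \<open>The graph is a star centred at \<open>x\<close>, since \<open>{x}\<close> is a vertex cover.\<close>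

lemma fixed_vertex_orbit_imp_complete_bipartite:
  assumes "{x} \<in> vertex_orbits \<Gamma> H"
  shows "\<exists>m n. complete_bipartite_digraph m n (with_proj \<Gamma>)"
proof -
  have x: "x \<in> pverts \<Gamma>" using orbit_nonempty[OF assms] by simp
  have arcs: "parcs \<Gamma> \<subseteq> {x} \<times> (pverts \<Gamma> - {x}) \<union> (pverts \<Gamma> - {x}) \<times> {x}"
    using orbit_vertex_cover[OF assms] no_loops' by (auto dest: in_arcsD1 in_arcsD2)
  have "(x, y) \<in> parcs \<Gamma>" if y: "y \<in> pverts \<Gamma> - {x}" for y
  proof -
    obtain z where "(y, z) \<in> parcs \<Gamma>" using has_neighbour[of y x] x y by auto
    then show ?thesis using arcs y arcs_symmetric by auto
  qed
  then show ?thesis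
    using complete_bipartiteI[of "{x}" "pverts \<Gamma> - {x}"] arcs x by auto
qed

text \<open>
  A nontrivial kernel on \<open>B\<close> is transitive on an orbit \<open>D\<close>. For \<open>D = B\<close> this makes \<open>B\<close> a singleton;
  otherwise one edge from \<open>x \<in> B\<close> to \<open>D\<close> is spread by the kernel, which fixes \<open>x\<close>, to all of \<open>D\<close>.
\<close>

lemma basic_faithful_on_orbits:
  assumes basic: "basic \<Gamma> H" "plus_subgroup \<Gamma> H = H"
    and not_bip: "\<nexists>m n. complete_bipartite_digraph m n (with_proj \<Gamma>)"
    and B: "B \<in> vertex_orbits \<Gamma> H"
  shows "faithful_action (perm_group \<Gamma> H) B (action_on B)"
proof (rule ccontr)
  assume unfaithful: "\<not> ?thesis"
  interpret B: group_action "perm_group \<Gamma> H" B "action_on B" by (rule orbit_group_action[OF B])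
  interpret hom: group_hom "perm_group \<Gamma> H" "BijGroup B" "action_on B" by (rule B.group_hom)
  define K where "K = kernel (perm_group \<Gamma> H) (BijGroup B) (action_on B)"
  have K: "K \<lhd> perm_group \<Gamma> H" unfolding K_def by (rule hom.normal_kernel)
  have KH: "K \<subseteq> H" by (auto simp: K_def kernel_def)
  have fixes_B: "k x = x" if "k \<in> K" "x \<in> B" for k x
  proof -
    have "action_on B k x = x" using that by (simp add: K_def kernel_def BijGroup_def)
    then show ?thesis using that by (simp add: action_on_def)
  qed
  have "K \<noteq> {\<one>\<^bsub>Aut \<Gamma>\<^esub>}"
    using unfaithful hom.trivial_ker_imp_inj B.group_action_axioms
    by (auto simp: K_def faithful_action_def faithful_action_axioms_def)
  then obtain D where D: "D \<in> vertex_orbits \<Gamma> H"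
    and tr: "transitive_action (perm_group \<Gamma> K) D (action_on D)"
    using basic_normal_transitive_on_some_orbit[OF basic K] by blast
  have move: "\<exists>k\<in>K. k x = y" if "x \<in> D" "y \<in> D" for x y
    using transitive_action.unique_orbit[OF tr that] that by (auto simp: action_on_def)
  show False
  proof (cases "D = B")
    case True
    then obtain x where "x \<in> B" using orbit_nonempty[OF B] by auto
    then have "B = {x}" using move fixes_B True by auto
    then show False using fixed_vertex_orbit_imp_complete_bipartite B not_bip by auto
  next
    case False
    note bip = orbits_bipartition[OF B D False[symmetric]]
    have "(x, y) \<in> parcs \<Gamma>" if xy: "x \<in> B" "y \<in> D" for x y
    proof -
      have "x \<in> pverts \<Gamma>" "y \<in> pverts \<Gamma>" "x \<noteq> y" using xy bip by auto
      then obtain z where z: "(x, z) \<in> parcs \<Gamma>" using has_neighbour by metis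
      then have "z \<in> D" using bip xy by auto
      then obtain k where k: "k \<in> K" "k z = y" using move xy by blast
      then show ?thesis using arc_image[OF _ z, of k] fixes_B[OF k(1) xy(1)] KH by auto
    qed
    then show False using complete_bipartiteI[OF bip(2,1,3)] not_bip by auto
  qed
qed

text \<open>
  Failure on every orbit yields two commuting normal subgroups, each semiregular and intransitive on
  the orbit on which the other is transitive; then each orbit would be smaller than the other.
\<close>

lemma basic_quasiprimitive_on_some_orbit:
  assumes basic: "basic \<Gamma> H" "plus_subgroup \<Gamma> H = H"
    and not_bip: "\<nexists>m n. complete_bipartite_digraph m n (with_proj \<Gamma>)"
  shows "\<exists>B \<in> vertex_orbits \<Gamma> H. quasiprimitive_action (perm_group \<Gamma> H) B (action_on B)"
proof (rule ccontr)
  assume none: "\<not> ?thesis"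
  let ?P = "perm_group \<Gamma> H"
  let ?trans = "\<lambda>N B. transitive_action (perm_group \<Gamma> N) B (action_on B)"
  note faithful = basic_faithful_on_orbits[OF basic not_bip]
  note some_trans = basic_normal_transitive_on_some_orbit[OF basic]
  have intrans: "\<exists>N. N \<lhd> ?P \<and> N \<noteq> {\<one>\<^bsub>Aut \<Gamma>\<^esub>} \<and> \<not> ?trans N B"
    if "B \<in> vertex_orbits \<Gamma> H" for B
    using none faithful that by (auto simp: quasiprimitive_action_def)
  have "pverts \<Gamma> \<noteq> {}" using connected by (auto simp: connected_conv)
  then obtain B where B: "B \<in> vertex_orbits \<Gamma> H" by (auto simp: orbits_def)
  then obtain M where M: "M \<lhd> ?P" "M \<noteq> {\<one>\<^bsub>Aut \<Gamma>\<^esub>}" "\<not> ?trans M B"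
    using intrans by blast
  then obtain D where D: "D \<in> vertex_orbits \<Gamma> H" "?trans M D" using some_trans by blast
  then have "B \<noteq> D" using M by auto
  note bip = orbits_bipartition[OF B D(1) this]
  obtain N where N: "N \<lhd> ?P" "N \<noteq> {\<one>\<^bsub>Aut \<Gamma>\<^esub>}" "\<not> ?trans N D"
    using intrans[OF D(1)] by blast
  obtain B' where "B' \<in> vertex_orbits \<Gamma> H" "?trans N B'" using some_trans[OF N(1,2)] by blast
  then have NB: "?trans N B" using N(3) bip(4) by auto
  interpret P: group ?P using H.group_hom by (simp add: group_hom_def)
  have mono: "?trans L' C" if "?trans L C" "L \<subseteq> L'" "L' \<lhd> ?P" "C \<in> vertex_orbits \<Gamma> H" for L L' C
    using group_action.transitive_action_mono[OF orbit_group_action[OF that(4)], of L L'] that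
      normal_imp_subgroup[OF that(3)] by simp
  have disj: "M \<inter> N = {\<one>\<^bsub>?P\<^esub>}"
  proof (rule ccontr)
    assume "M \<inter> N \<noteq> {\<one>\<^bsub>?P\<^esub>}"
    then obtain C where C: "C \<in> vertex_orbits \<Gamma> H" "?trans (M \<inter> N) C"
      using some_trans[OF P.normal_subgroup_intersect[OF M(1) N(1)]] by auto
    then have "?trans M C" "?trans N C"
      using mono[OF C(2) _ M(1) C(1)] mono[OF C(2) _ N(1) C(1)] by auto
    then show False using C(1) bip(4) M(3) N(3) by auto
  qed
  have finB: "finite B" and finD: "finite D" using bip(2) pair_finite_verts by auto
  interpret FB: faithful_action ?P B "action_on B" by (rule faithful[OF B])
  interpret FD: faithful_action ?P D "action_on D" by (rule faithful[OF D(1)])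
  have M_card: "finite M" "card M < card B"
    using FB.card_intransitive_normal_less[OF finB N(1) M(1) disj] NB M(3) by auto
  have N_card: "finite N" "card N < card D"
    using FD.card_intransitive_normal_less[OF finD M(1) N(1)] disj D(2) N(3) by (auto simp: Int_commute)
  have "card D \<le> card M" using transitive_action.card_le_carrier[OF D(2)] M_card by simp
  moreover have "card B \<le> card N" using transitive_action.card_le_carrier[OF NB] N_card by simp
  ultimately show False using M_card N_card by simp
qed

end

section \<open>Locally distance transitive graphs\<close>

lemma (in pair_graph) graph_dist_arc:
  assumes "(v, w) \<in> parcs G"
  shows "graph_dist G v w = 1"
  unfolding graph_dist_def
proof (rule Least_equality)
  have "v \<noteq> w" using assms by (rule no_loops')
  then show "\<exists>p. apath v p w \<and> length p = 1"
    using assms in_arcsD2[OF assms] by (intro exI[of _ "[(v, w)]"]) (auto simp: apath_simps)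
  fix n assume "\<exists>p. apath v p w \<and> length p = n"
  then show "1 \<le> n" using \<open>v \<noteq> w\<close> by (cases n) (auto simp: apath_simps)
qed

lemma (in pair_graph) graph_diam_pos:
  assumes "(v, w) \<in> parcs G"
  shows "graph_diam G \<ge> 1"
proof -
  let ?S = "{graph_dist G u v | u v. u \<in> pverts G \<and> v \<in> pverts G}"
  have "?S = (\<lambda>(u, v). graph_dist G u v) ` (pverts G \<times> pverts G)" by auto
  then have "finite ?S" using pair_finite_verts by simp
  moreover have "1 \<in> ?S"
    using graph_dist_arc[OF assms] in_arcsD1[OF assms] in_arcsD2[OF assms] by force
  ultimately show ?thesis unfolding graph_diam_def by (rule Max_ge)
qed

lemma LDT_rel_locally_transitive_graph:
  assumes "s \<ge> 1" "LDT_rel s \<Gamma> G"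
  shows "locally_transitive_graph \<Gamma> G"
proof -
  interpret pair_graph \<Gamma> using assms(2) by (simp add: LDT_rel_def)
  show ?thesis
  proof (intro locally_transitive_graph.intro[OF pair_graph] locally_transitive_graph_axioms.intro)
    show "subgroup G (Aut \<Gamma>)" "Digraph_Component.connected (with_proj \<Gamma>)"
      using assms(2) by (auto simp: LDT_rel_def locally_distance_transitive_def)
    fix v u w assume arcs: "(v, u) \<in> parcs \<Gamma>" "(v, w) \<in> parcs \<Gamma>"
    let ?S = "graph_sphere \<Gamma> v 1"
    have S: "u \<in> ?S" "w \<in> ?S" and "v \<in> pverts \<Gamma>"
      using arcs graph_dist_arc in_arcsD1 in_arcsD2 by (auto simp: graph_sphere_def)
    then have "transitive_action (perm_group \<Gamma> (vertex_stabilizer \<Gamma> G v)) ?S (action_on ?S)"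
      using assms graph_diam_pos[OF arcs(1)]
      by (auto simp: LDT_rel_def locally_distance_transitive_def)
    from transitive_action.unique_orbit[OF this S] S show "\<exists>g \<in> G. g v = v \<and> g u = w"
      by (auto simp: action_on_def vertex_stabilizer_eq)
  qed
qed

theorem theorem1p3:
  fixes \<Gamma> :: "'a pair_pre_digraph" and G :: "('a \<Rightarrow> 'a) set" and s :: nat
  assumes "s \<ge> 1"
    and "LDT_rel s \<Gamma> G"
  shows "LDT_rel s \<Gamma> (plus_subgroup \<Gamma> G) \<and>
    (basic \<Gamma> (plus_subgroup \<Gamma> G) \<longrightarrow>
       (\<exists>m n. complete_bipartite_digraph m n (with_proj \<Gamma>)) \<or>
       ((\<forall>B \<in> vertex_orbits \<Gamma> (plus_subgroup \<Gamma> G).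
           faithful_action (perm_group \<Gamma> (plus_subgroup \<Gamma> G)) B (action_on B)) \<and>
        (\<exists>B \<in> vertex_orbits \<Gamma> (plus_subgroup \<Gamma> G).
           quasiprimitive_action (perm_group \<Gamma> (plus_subgroup \<Gamma> G)) B (action_on B))))"
proof -
  note LDT = LDT_rel_plus[OF assms(2)]
  interpret locally_transitive_graph \<Gamma> "plus_subgroup \<Gamma> G"
    using LDT_rel_locally_transitive_graph[OF assms(1) LDT] .
  have "subgroup G (Aut \<Gamma>)"
    using assms(2) by (simp add: LDT_rel_def locally_distance_transitive_def)
  note idem = plus_subgroup_idem[OF this]
  show ?thesis
    using LDT basic_faithful_on_orbits[OF _ idem] basic_quasiprimitive_on_some_orbit[OF _ idem]
    by blast
qed

end
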